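(* Let $T:\hat{\mathcal{B}}_\infty\to V$ be a continuous map from the bottleneck-completed space of barcodes $\hat{\mathcal{B}}_\infty$ to a separable Banach space $V$. Let $\{X_i\}_{i\in\mathbb{N}}$ be an i.i.d. sequence of $\hat{\mathcal{B}}_\infty$-valued random variables such that $\mathbb{E}[\|T(X_1)\|]<\infty$. Then the sequence of random variables $(S_n)_n$, where $$S_n:=\frac{T(X_1)+\ldots+T(X_n)}{n},$$ converges almost surely to $\mathbb{E}[T(X_1)]$.
   Context: Barcode space: $\mathcal{B}$ is the set of finite multisets of pairs $(x,d)\in\mathbb{R}_{\ge0}^2$ (an interval with left endpoint $x$ and length $d$), where two multisets are identified if they agree after deleting pairs with $d=0$. Bottleneck distance: put $d_\infty((x_1,d_1),(x_2,d_2))=\max(|x_1-x_2|,|(x_1+d_1)-(x_2+d_2)|)$ and $d_\infty((x,d),\Delta)=d/2$. For $b_1=\{I_i\}_{i=1}^n$, $b_2=\{J_j\}_{j=1}^m$, $d_\infty(b_1,b_2)$ is the minimum over all bijections $\theta:A\to B$ with $A\subset\{1,\dots,n\}$, $B\subset\{1,\dots,m\}$ of $\max\big(\max_{a\in A}d_\infty(I_a,J_{\theta(a)}),\max_{a\notin A}d_\infty(I_a,\Delta),\max_{b\notin B}d_\infty(J_b,\Delta)\big)$. $\hat{\mathcal{B}}_\infty$ is the completion of $(\mathcal{B},d_\infty)$. Expectation of a $V$-valued random variable $\xi$ is its Pettis integral: the element $v=\mathbb{E}[\xi]\in V$ with $\varphi(v)=\mathbb{E}[\varphi(\xi)]$ for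 every continuous linear functional $\varphi$ on $V$; it exists if $\mathbb{E}[\|\xi\|]<\infty$. *)

theory Defs
  imports "HOL-Probability.Probability" "HOL-Combinatorics.List_Permutation"
begin

section \<open>Intervals and the bottleneck distance of indexed families\<close>

text \<open>An interval is the pair \<open>(x, d)\<close> of its left endpoint and its length.\<close>

type_synonym bar = "real \<times> real"

definition valid_bar :: "bar \<Rightarrow> bool" where
  "valid_bar I \<longleftrightarrow> 0 \<le> fst I \<and> 0 \<le> snd I"

definition bar_dist :: "bar \<Rightarrow> bar \<Rightarrow> real" where
  "bar_dist I J = max \<bar>fst I - fst J\<bar> \<bar>(fst I + snd I) - (fst J + snd J)\<bar>"

definition diag_dist :: "bar \<Rightarrow> real" where
  "diag_dist I = snd I / 2"

text \<open>
  A list enumerates a multiset of intervals, with indices starting at \<open>0\<close>.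
  The element \<open>0\<close> only fixes the maximum over an empty index set; all other
  elements are nonnegative when the intervals are valid.
\<close>

definition matching_cost ::
    "bar list \<Rightarrow> bar list \<Rightarrow> nat set \<Rightarrow> nat set \<Rightarrow> (nat \<Rightarrow> nat) \<Rightarrow> real" where
  "matching_cost Is Js A B \<theta> =
     Max ({0} \<union> (\<lambda>a. bar_dist (Is ! a) (Js ! \<theta> a)) ` A
              \<union> (\<lambda>a. diag_dist (Is ! a)) ` ({..<length Is} - A)
              \<union> (\<lambda>b. diag_dist (Js ! b)) ` ({..<length Js} - B))"

definition bottleneck_list :: "bar list \<Rightarrow> bar list \<Rightarrow> real" where
  "bottleneck_list Is Js =
     Min {matching_cost Is Js A B \<theta> |A B \<theta>.
            A \<subseteq> {..<length Is} \<and> B \<subseteq> {..<length Js} \<and> bij_betw \<theta> A B}"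

definition bottleneck_mset :: "bar multiset \<Rightarrow> bar multiset \<Rightarrow> real" where
  "bottleneck_mset M N = bottleneck_list (SOME Is. mset Is = M) (SOME Js. mset Js = N)"

text \<open>
  Independence of the chosen enumerations is \<open>bottleneck_mset_eq\<close> below.
\<close>

definition matched :: "real \<Rightarrow> bar list \<Rightarrow> bar list \<Rightarrow> bool" where
  "matched r Is Js \<longleftrightarrow> 0 \<le> r \<and> (\<exists>A B \<theta>. A \<subseteq> {..<length Is} \<and> B \<subseteq> {..<length Js} \<and> bij_betw \<theta> A B \<and>
      (\<forall>a\<in>A. bar_dist (Is ! a) (Js ! \<theta> a) \<le> r) \<and>
      (\<forall>a\<in>{..<length Is} - A. diag_dist (Is ! a) \<le> r) \<and>
      (\<forall>b\<in>{..<length Js} - B. diag_dist (Js ! b) \<le> r))"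

lemma bar_dist_sym: "bar_dist I J = bar_dist J I"
  by (simp add: bar_dist_def abs_minus_commute)

lemma bar_dist_triangle: "bar_dist I K \<le> bar_dist I J + bar_dist J K"
  unfolding bar_dist_def by (smt (verit) max_def)

lemma diag_dist_triangle: "diag_dist I \<le> bar_dist I J + diag_dist J"
  unfolding bar_dist_def diag_dist_def by (smt (verit) max_def field_sum_of_halves)

lemma bar_dist_zero: "bar_dist I J \<le> 0 \<longleftrightarrow> I = J"
  by (auto simp: bar_dist_def prod_eq_iff)

lemma matching_cost_le_iff:
  assumes "A \<subseteq> {..<length Is}" "B \<subseteq> {..<length Js}"
  shows "matching_cost Is Js A B \<theta> \<le> r \<longleftrightarrow> 0 \<le> r \<and>
      (\<forall>a\<in>A. bar_dist (Is ! a) (Js ! \<theta> a) \<le> r) \<and>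
      (\<forall>a\<in>{..<length Is} - A. diag_dist (Is ! a) \<le> r) \<and>
      (\<forall>b\<in>{..<length Js} - B. diag_dist (Js ! b) \<le> r)"
proof -
  have "finite A" "finite B"
    using assms finite_subset by blast+
  then show ?thesis
    unfolding matching_cost_def by (subst Max_le_iff) (auto simp: ball_Un)
qed

abbreviation (input) costs :: "bar list \<Rightarrow> bar list \<Rightarrow> real set" where
  "costs Is Js \<equiv> {matching_cost Is Js A B \<theta> |A B \<theta>.
            A \<subseteq> {..<length Is} \<and> B \<subseteq> {..<length Js} \<and> bij_betw \<theta> A B}"

lemma finite_costs: "finite (costs Is Js)"
proof -
  let ?F = "{0} \<union> (\<lambda>(a, b). bar_dist (Is ! a) (Js ! b)) ` ({..<length Is} \<times> {..<length Js})
              \<union> (\<lambda>a. diag_dist (Is ! a)) ` {..<length Is}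
              \<union> (\<lambda>b. diag_dist (Js ! b)) ` {..<length Js}"
  have "costs Is Js \<subseteq> ?F"
  proof
    fix c assume "c \<in> costs Is Js"
    then obtain A B \<theta> where c: "c = matching_cost Is Js A B \<theta>"
      and AB: "A \<subseteq> {..<length Is}" "B \<subseteq> {..<length Js}" "bij_betw \<theta> A B" by auto
    let ?S = "{0} \<union> (\<lambda>a. bar_dist (Is ! a) (Js ! \<theta> a)) ` A
              \<union> (\<lambda>a. diag_dist (Is ! a)) ` ({..<length Is} - A)
              \<union> (\<lambda>b. diag_dist (Js ! b)) ` ({..<length Js} - B)"
    have "finite A" using AB finite_subset by blast
    then have "c \<in> ?S"
      unfolding c matching_cost_def by (intro Max_in) auto
    moreover have "(\<lambda>a. bar_dist (Is ! a) (Js ! \<theta> a)) ` A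
        \<subseteq> (\<lambda>(a, b). bar_dist (Is ! a) (Js ! b)) ` ({..<length Is} \<times> {..<length Js})"
    proof
      fix z assume "z \<in> (\<lambda>a. bar_dist (Is ! a) (Js ! \<theta> a)) ` A"
      then obtain a where a: "a \<in> A" "z = bar_dist (Is ! a) (Js ! \<theta> a)" by auto
      then have "(a, \<theta> a) \<in> {..<length Is} \<times> {..<length Js}"
        using AB by (auto simp: bij_betw_def)
      then show "z \<in> (\<lambda>(a, b). bar_dist (Is ! a) (Js ! b)) ` ({..<length Is} \<times> {..<length Js})"
        using a(2) by (intro image_eqI[of _ _ "(a, \<theta> a)"]) auto
    qed
    ultimately show "c \<in> ?F" by auto
  qed
  then show ?thesis by (rule finite_subset) auto
qed

lemma costs_nonempty: "costs Is Js \<noteq> {}"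
  using bij_betw_empty1 by (auto intro!: exI[of _ "{}"] simp: bij_betw_def)

lemma bottleneck_list_le_iff: "bottleneck_list Is Js \<le> r \<longleftrightarrow> matched r Is Js"
proof -
  have "bottleneck_list Is Js \<le> r \<longleftrightarrow> (\<exists>c\<in>costs Is Js. c \<le> r)"
    unfolding bottleneck_list_def by (rule Min_le_iff[OF finite_costs costs_nonempty])
  also have "\<dots> \<longleftrightarrow> (\<exists>A B \<theta>. (A \<subseteq> {..<length Is} \<and> B \<subseteq> {..<length Js} \<and> bij_betw \<theta> A B) \<and>
      matching_cost Is Js A B \<theta> \<le> r)"
    (is "?L \<longleftrightarrow> ?R")
  proof
    assume ?L
    then obtain c where "c \<in> costs Is Js" "c \<le> r" ..
    then show ?R by auto
  next
    assume ?R
    then obtain A B \<theta> where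
      "A \<subseteq> {..<length Is}" "B \<subseteq> {..<length Js}" "bij_betw \<theta> A B" "matching_cost Is Js A B \<theta> \<le> r"
      by auto
    then show ?L by (intro bexI[of _ "matching_cost Is Js A B \<theta>"]) auto
  qed
  also have "\<dots> \<longleftrightarrow> matched r Is Js"
    (is "_ \<longleftrightarrow> ?M")
  proof
    assume ?R
    then obtain A B \<theta> where
      *: "A \<subseteq> {..<length Is}" "B \<subseteq> {..<length Js}" "bij_betw \<theta> A B" "matching_cost Is Js A B \<theta> \<le> r"
      by auto
    show ?M
      unfolding matched_def using * matching_cost_le_iff[OF *(1,2), of \<theta> r]
      by (intro conjI exI[of _ A] exI[of _ B] exI[of _ \<theta>]) simp_all
  next
    assume ?M
    then obtain A B \<theta> where *: "0 \<le> r" "A \<subseteq> {..<length Is}" "B \<subseteq> {..<length Js}" "bij_betw \<theta> A B"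
      "\<forall>a\<in>A. bar_dist (Is ! a) (Js ! \<theta> a) \<le> r"
      "\<forall>a\<in>{..<length Is} - A. diag_dist (Is ! a) \<le> r"
      "\<forall>b\<in>{..<length Js} - B. diag_dist (Js ! b) \<le> r"
      unfolding matched_def by (elim conjE exE)
    then have "matching_cost Is Js A B \<theta> \<le> r"
      using matching_cost_le_iff[OF *(2,3), of \<theta> r] by simp
    then show ?R using * by (intro exI[of _ A] exI[of _ B] exI[of _ \<theta>]) simp
  qed
  finally show ?thesis .
qed

lemma matched_bottleneck: "matched (bottleneck_list Is Js) Is Js"
  using bottleneck_list_le_iff by blast

lemma bottleneck_list_nonneg: "0 \<le> bottleneck_list Is Js"
  using matched_bottleneck unfolding matched_def by blast

lemma matched_sym:
  assumes "matched r Is Js"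
  shows "matched r Js Is"
proof -
  obtain A B \<theta> where *: "0 \<le> r" "A \<subseteq> {..<length Is}" "B \<subseteq> {..<length Js}" "bij_betw \<theta> A B"
      "\<forall>a\<in>A. bar_dist (Is ! a) (Js ! \<theta> a) \<le> r"
      "\<forall>a\<in>{..<length Is} - A. diag_dist (Is ! a) \<le> r"
      "\<forall>b\<in>{..<length Js} - B. diag_dist (Js ! b) \<le> r"
    using assms unfolding matched_def by (elim conjE exE)
  have "bij_betw (inv_into A \<theta>) B A"
    using * bij_betw_inv_into by blast
  moreover have "\<forall>b\<in>B. bar_dist (Js ! b) (Is ! inv_into A \<theta> b) \<le> r"
    using * bij_betw_inv_into_right[OF *(4)] bij_betwE[OF bij_betw_inv_into[OF *(4)]]
    by (metis bar_dist_sym)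
  ultimately show ?thesis
    unfolding matched_def using *
    by (intro conjI exI[of _ B] exI[of _ A] exI[of _ "inv_into A \<theta>"]) simp_all
qed

lemma matched_trans:
  assumes "matched r Is Js" "matched s Js Ks"
  shows "matched (r + s) Is Ks"
proof -
  obtain A B \<theta> where 1: "0 \<le> r" "A \<subseteq> {..<length Is}" "B \<subseteq> {..<length Js}" "bij_betw \<theta> A B"
      "\<forall>a\<in>A. bar_dist (Is ! a) (Js ! \<theta> a) \<le> r"
      "\<forall>a\<in>{..<length Is} - A. diag_dist (Is ! a) \<le> r"
      "\<forall>b\<in>{..<length Js} - B. diag_dist (Js ! b) \<le> r"
    using assms(1) unfolding matched_def by (elim conjE exE)
  obtain C D \<eta> where 2: "0 \<le> s" "C \<subseteq> {..<length Js}" "D \<subseteq> {..<length Ks}" "bij_betw \<eta> C D"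
      "\<forall>a\<in>C. bar_dist (Js ! a) (Ks ! \<eta> a) \<le> s"
      "\<forall>a\<in>{..<length Js} - C. diag_dist (Js ! a) \<le> s"
      "\<forall>b\<in>{..<length Ks} - D. diag_dist (Ks ! b) \<le> s"
    using assms(2) unfolding matched_def by (elim conjE exE)
  let ?A = "{a \<in> A. \<theta> a \<in> C}" and ?f = "\<eta> \<circ> \<theta>"
  have inj: "inj_on ?f ?A"
    using 1(4) 2(4) unfolding bij_betw_def inj_on_def by auto
  have sub: "?f ` ?A \<subseteq> {..<length Ks}"
    using 2(3,4) unfolding bij_betw_def by auto
  have m: "\<forall>a\<in>?A. bar_dist (Is ! a) (Ks ! ?f a) \<le> r + s"
  proof
    fix a assume "a \<in> ?A"
    then have "bar_dist (Is ! a) (Js ! \<theta> a) \<le> r" "bar_dist (Js ! \<theta> a) (Ks ! \<eta> (\<theta> a)) \<le> s"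
      using 1(5) 2(5) by auto
    then show "bar_dist (Is ! a) (Ks ! ?f a) \<le> r + s"
      using bar_dist_triangle[of "Is ! a" "Ks ! ?f a" "Js ! \<theta> a"] by simp
  qed
  have l: "\<forall>a\<in>{..<length Is} - ?A. diag_dist (Is ! a) \<le> r + s"
  proof
    fix a assume a: "a \<in> {..<length Is} - ?A"
    show "diag_dist (Is ! a) \<le> r + s"
    proof (cases "a \<in> A")
      case True
      then have "bar_dist (Is ! a) (Js ! \<theta> a) \<le> r" "\<theta> a \<in> {..<length Js} - C"
        using 1(3,4,5) a by (auto simp: bij_betw_def)
      then show ?thesis
        using diag_dist_triangle[of "Is ! a" "Js ! \<theta> a"] 2(6) by force
    next
      case False
      then show ?thesis using 1(6) 2(1) a by force
    qed
  qed
  have k: "\<forall>b\<in>{..<length Ks} - ?f ` ?A. diag_dist (Ks ! b) \<le> r + s"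
  proof
    fix b assume b: "b \<in> {..<length Ks} - ?f ` ?A"
    show "diag_dist (Ks ! b) \<le> r + s"
    proof (cases "b \<in> D")
      case True
      then obtain c where c: "c \<in> C" "b = \<eta> c" using 2(4) by (auto simp: bij_betw_def)
      have "c \<notin> B"
      proof
        assume "c \<in> B"
        then obtain a where "a \<in> A" "c = \<theta> a" using 1(4) by (auto simp: bij_betw_def)
        then have "b \<in> ?f ` ?A" using c by auto
        then show False using b by simp
      qed
      then have "diag_dist (Js ! c) \<le> r" "bar_dist (Js ! c) (Ks ! b) \<le> s"
        using 1(7) 2(2,5) c by auto
      then show ?thesis
        using diag_dist_triangle[of "Ks ! b" "Js ! c"] bar_dist_sym[of "Ks ! b"] by simp
    next
      case False
      then show ?thesis using 2(7) 1(1) b by force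
    qed
  qed
  show ?thesis
    unfolding matched_def
    using 1(1,2) 2(1) inj sub m l k
    by (intro conjI exI[of _ ?A] exI[of _ "?f ` ?A"] exI[of _ ?f]) (auto simp: bij_betw_def)
qed

lemma matched_zero_trans: "matched 0 Is Js \<Longrightarrow> matched 0 Js Ks \<Longrightarrow> matched 0 Is Ks"
  using matched_trans[of 0 Is Js 0 Ks] by simp

lemma bottleneck_list_sym: "bottleneck_list Is Js = bottleneck_list Js Is"
  by (intro antisym) (simp_all add: bottleneck_list_le_iff matched_sym matched_bottleneck)

lemma bottleneck_list_triangle:
  "bottleneck_list Is Ks \<le> bottleneck_list Is Js + bottleneck_list Js Ks"
  unfolding bottleneck_list_le_iff by (rule matched_trans[OF matched_bottleneck matched_bottleneck])

lemma matched_zero_perm: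
  assumes "mset Is = mset Js"
  shows "matched 0 Is Js"
proof -
  obtain f where f: "bij_betw f {..<length Is} {..<length Js}" "\<forall>i<length Is. Is ! i = Js ! f i"
    using assms permutation_Ex_bij by metis
  then show ?thesis
    unfolding matched_def
    by (intro conjI exI[of _ "{..<length Is}"] exI[of _ "{..<length Js}"] exI[of _ f])
       (auto simp: bar_dist_zero)
qed

lemma matched_zero_append:
  assumes "\<forall>I\<in>set Js. snd I = 0"
  shows "matched 0 (Is @ Js) Is"
  unfolding matched_def
  using assms
  by (intro conjI exI[of _ "{..<length Is}"] exI[of _ "{..<length Is}"] exI[of _ id])
     (auto simp: bar_dist_zero nth_append diag_dist_def)

lemma matched_zero_filter: "matched 0 Is (filter (\<lambda>I. snd I \<noteq> 0) Is)"
proof -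
  let ?P = "\<lambda>I::bar. snd I \<noteq> 0"
  have "mset Is = mset (filter ?P Is @ filter (\<lambda>I. \<not> ?P I) Is)"
    by (simp add: multiset_partition[of "mset Is" ?P, symmetric])
  from matched_zero_perm[OF this] matched_zero_append[of "filter (\<lambda>I. \<not> ?P I) Is" "filter ?P Is"]
  show ?thesis by (auto intro: matched_zero_trans)
qed

lemma matched_zero_iff:
  assumes "\<forall>I\<in>set Is. valid_bar I" "\<forall>J\<in>set Js. valid_bar J"
  shows "matched 0 Is Js \<longleftrightarrow>
    filter_mset (\<lambda>I. snd I \<noteq> 0) (mset Is) = filter_mset (\<lambda>I. snd I \<noteq> 0) (mset Js)"
proof
  assume "filter_mset (\<lambda>I. snd I \<noteq> 0) (mset Is) = filter_mset (\<lambda>I. snd I \<noteq> 0) (mset Js)"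
  then have "mset (filter (\<lambda>I. snd I \<noteq> 0) Is) = mset (filter (\<lambda>I. snd I \<noteq> 0) Js)" by simp
  from matched_zero_perm[OF this] show "matched 0 Is Js"
    by (intro matched_zero_trans[OF matched_zero_filter[of Is]]
          matched_zero_trans[OF _ matched_sym[OF matched_zero_filter[of Js]]])
next
  assume "matched 0 Is Js"
  then obtain A B \<theta> where *: "A \<subseteq> {..<length Is}" "B \<subseteq> {..<length Js}" "bij_betw \<theta> A B"
      "\<forall>a\<in>A. bar_dist (Is ! a) (Js ! \<theta> a) \<le> 0"
      "\<forall>a\<in>{..<length Is} - A. diag_dist (Is ! a) \<le> 0"
      "\<forall>b\<in>{..<length Js} - B. diag_dist (Js ! b) \<le> 0"
    unfolding matched_def by (elim conjE exE)
  have zero_off: "snd (Is ! a) = 0" if a: "a < length Is" "a \<notin> A" for a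
  proof -
    have "diag_dist (Is ! a) \<le> 0" "valid_bar (Is ! a)"
      using *(5) a assms(1) by auto
    then show ?thesis by (simp add: diag_dist_def valid_bar_def)
  qed
  have zero_off': "snd (Js ! b) = 0" if b: "b < length Js" "b \<notin> B" for b
  proof -
    have "diag_dist (Js ! b) \<le> 0" "valid_bar (Js ! b)"
      using *(6) b assms(2) by auto
    then show ?thesis by (simp add: diag_dist_def valid_bar_def)
  qed
  have eq: "Is ! a = Js ! \<theta> a" if "a \<in> A" for a
    using *(4) that bar_dist_zero by blast
  let ?A = "{a \<in> {..<length Is}. snd (Is ! a) \<noteq> 0}" and ?B = "{b \<in> {..<length Js}. snd (Js ! b) \<noteq> 0}"
  have "?A \<subseteq> A" using zero_off by auto
  have inj: "inj_on \<theta> ?A"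
    using *(3) \<open>?A \<subseteq> A\<close> unfolding bij_betw_def by (blast intro: inj_on_subset)
  have img: "\<theta> ` ?A = ?B"
  proof (intro equalityI subsetI)
    fix b assume "b \<in> \<theta> ` ?A"
    then obtain a where a: "a \<in> ?A" "b = \<theta> a" by blast
    then have "a \<in> A" using \<open>?A \<subseteq> A\<close> by blast
    then show "b \<in> ?B" using a eq[of a] *(2,3) by (auto simp: bij_betw_def)
  next
    fix b assume b: "b \<in> ?B"
    then have "b \<in> B" using zero_off' by auto
    then obtain a where "a \<in> A" "b = \<theta> a" using *(3) by (auto simp: bij_betw_def)
    then show "b \<in> \<theta> ` ?A" using b eq[of a] *(1) by auto
  qed
  have ms: "mset Ls = image_mset (\<lambda>i. Ls ! i) (mset_set {..<length Ls})" for Ls :: "bar list"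
    by (metis atLeast_upt map_nth mset_map mset_upt lessThan_atLeast0)
  have fs: "filter_mset (\<lambda>I. snd I \<noteq> 0) (mset Ls)
      = image_mset (\<lambda>i. Ls ! i) (mset_set {i \<in> {..<length Ls}. snd (Ls ! i) \<noteq> 0})" for Ls :: "bar list"
    by (subst ms) (simp add: filter_mset_image_mset)
  have "image_mset (\<lambda>i. Js ! i) (mset_set ?B) = image_mset (\<lambda>i. Js ! \<theta> i) (mset_set ?A)"
    unfolding img[symmetric] image_mset_mset_set[OF inj, symmetric]
    by (simp add: multiset.map_comp comp_def)
  also have "\<dots> = image_mset (\<lambda>i. Is ! i) (mset_set ?A)"
  proof (rule image_mset_cong)
    fix a assume "a \<in># mset_set ?A"
    then have "a \<in> A" using \<open>?A \<subseteq> A\<close> by auto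
    then show "Js ! \<theta> a = Is ! a" using eq by simp
  qed
  finally show "filter_mset (\<lambda>I. snd I \<noteq> 0) (mset Is) = filter_mset (\<lambda>I. snd I \<noteq> 0) (mset Js)"
    unfolding fs by simp
qed

lemma bottleneck_list_zero_iff:
  assumes "\<forall>I\<in>set Is. valid_bar I" "\<forall>J\<in>set Js. valid_bar J"
  shows "bottleneck_list Is Js = 0 \<longleftrightarrow>
    filter_mset (\<lambda>I. snd I \<noteq> 0) (mset Is) = filter_mset (\<lambda>I. snd I \<noteq> 0) (mset Js)"
  using matched_zero_iff[OF assms] bottleneck_list_le_iff bottleneck_list_nonneg by (metis antisym order_refl)

lemma bottleneck_list_cong:
  assumes "matched 0 Is Is'" "matched 0 Js Js'"
  shows "bottleneck_list Is Js = bottleneck_list Is' Js'"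
proof -
  have 1: "bottleneck_list Is Is' \<le> 0" "bottleneck_list Js Js' \<le> 0"
    using assms bottleneck_list_le_iff by blast+
  show ?thesis
    using 1 bottleneck_list_triangle[of Is Js Is'] bottleneck_list_triangle[of Is' Js Js']
      bottleneck_list_triangle[of Is' Js' Is] bottleneck_list_triangle[of Is Js' Js]
      bottleneck_list_sym[of Is Is'] bottleneck_list_sym[of Js Js'] by linarith
qed

lemma bottleneck_mset_eq:
  "bottleneck_mset (mset Is) (mset Js) = bottleneck_list Is Js"
  unfolding bottleneck_mset_def
proof (rule bottleneck_list_cong)
  show "matched 0 (SOME Is'. mset Is' = mset Is) Is"
    by (rule matched_zero_perm) (rule someI[of _ Is], simp)
  show "matched 0 (SOME Js'. mset Js' = mset Js) Js"
    by (rule matched_zero_perm) (rule someI[of _ Js], simp)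
qed


section \<open>The barcode space\<close>

definition barcode_rel :: "bar multiset \<Rightarrow> bar multiset \<Rightarrow> bool" where
  "barcode_rel M N \<longleftrightarrow> (\<forall>I\<in>#M. valid_bar I) \<and> (\<forall>I\<in>#N. valid_bar I) \<and>
     filter_mset (\<lambda>I. snd I \<noteq> 0) M = filter_mset (\<lambda>I. snd I \<noteq> 0) N"

lemma part_equivp_barcode_rel: "part_equivp barcode_rel"
  by (rule part_equivpI) (auto simp: barcode_rel_def symp_def transp_def intro!: exI[of _ "{#}"])

quotient_type barcode = "bar multiset" / partial: barcode_rel
  by (rule part_equivp_barcode_rel)

lemma barcode_rel_iff: "barcode_rel (mset Is) (mset Js) \<longleftrightarrow>
    (\<forall>I\<in>set Is. valid_bar I) \<and> (\<forall>J\<in>set Js. valid_bar J) \<and> bottleneck_list Is Js = 0"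
  using bottleneck_list_zero_iff[of Is Js] by (auto simp: barcode_rel_def)

instantiation barcode :: metric_space
begin

lift_definition dist_barcode :: "barcode \<Rightarrow> barcode \<Rightarrow> real" is bottleneck_mset
proof -
  fix M M' N N' assume *: "barcode_rel M M'" "barcode_rel N N'"
  obtain Is Is' Js Js' where l: "M = mset Is" "M' = mset Is'" "N = mset Js" "N' = mset Js'"
    by (metis ex_mset)
  have "matched 0 Is Is'" "matched 0 Js Js'"
    using * unfolding l barcode_rel_iff by (auto simp flip: bottleneck_list_le_iff)
  then show "bottleneck_mset M N = bottleneck_mset M' N'"
    unfolding l bottleneck_mset_eq by (rule bottleneck_list_cong)
qed

definition uniformity_barcode :: "(barcode \<times> barcode) filter" where
  "uniformity_barcode = (INF e\<in>{0 <..}. principal {(x, y). dist x y < e})"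

definition open_barcode :: "barcode set \<Rightarrow> bool" where
  "open_barcode S = (\<forall>x\<in>S. \<forall>\<^sub>F (x', y) in uniformity. x' = x \<longrightarrow> y \<in> S)"

instance
proof
  fix x y z :: barcode
  show "dist x y = 0 \<longleftrightarrow> x = y"
  proof transfer
    fix M N assume "barcode_rel M M" "barcode_rel N N"
    moreover obtain Is Js where "M = mset Is" "N = mset Js" by (metis ex_mset)
    ultimately show "bottleneck_mset M N = 0 \<longleftrightarrow> barcode_rel M N"
      by (simp add: barcode_rel_iff bottleneck_mset_eq)
  qed
  show "dist x y \<le> dist x z + dist y z"
  proof transfer
    fix M N L :: "bar multiset"
    obtain Is Js Ks where "M = mset Is" "N = mset Js" "L = mset Ks" by (metis ex_mset)
    then show "bottleneck_mset M N \<le> bottleneck_mset M L + bottleneck_mset N L"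
      using bottleneck_list_triangle[of Is Js Ks]
      by (simp add: bottleneck_mset_eq bottleneck_list_sym[of Js Ks])
  qed
qed (simp_all add: uniformity_barcode_def open_barcode_def)

end


section \<open>The completion of a metric space\<close>

definition completion_rel :: "(nat \<Rightarrow> 'a::metric_space) \<Rightarrow> (nat \<Rightarrow> 'a) \<Rightarrow> bool" where
  "completion_rel X Y \<longleftrightarrow> Cauchy X \<and> Cauchy Y \<and> (\<lambda>n. dist (X n) (Y n)) \<longlonglongrightarrow> 0"

lemma part_equivp_completion_rel: "part_equivp (completion_rel :: (nat \<Rightarrow> 'a::metric_space) \<Rightarrow> _)"
proof (rule part_equivpI)
  have "Cauchy (\<lambda>_::nat. undefined :: 'a)"
    by (intro LIMSEQ_imp_Cauchy[of _ undefined]) simp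
  then show "\<exists>X::nat \<Rightarrow> 'a. completion_rel X X"
    unfolding completion_rel_def by auto
  show "symp (completion_rel :: (nat \<Rightarrow> 'a) \<Rightarrow> _)"
    by (auto simp: symp_def completion_rel_def dist_commute)
  show "transp (completion_rel :: (nat \<Rightarrow> 'a) \<Rightarrow> _)"
  proof (rule transpI)
    fix X Y Z :: "nat \<Rightarrow> 'a" assume *: "completion_rel X Y" "completion_rel Y Z"
    then have s: "(\<lambda>n. dist (X n) (Y n) + dist (Y n) (Z n)) \<longlonglongrightarrow> 0"
      unfolding completion_rel_def by (intro tendsto_add_zero) auto
    have "(\<lambda>n. dist (X n) (Z n)) \<longlonglongrightarrow> 0"
      by (rule Lim_null_comparison[OF _ s]) (simp add: dist_triangle)
    then show "completion_rel X Z" using * by (simp add: completion_rel_def)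
  qed
qed

quotient_type (overloaded) 'a metric_completion =
    "nat \<Rightarrow> 'a::metric_space" / partial: completion_rel
  by (rule part_equivp_completion_rel)

lemma convergent_dist_Cauchy:
  fixes X Y :: "nat \<Rightarrow> 'a::metric_space"
  assumes "Cauchy X" "Cauchy Y"
  shows "(\<lambda>n. dist (X n) (Y n)) \<longlonglongrightarrow> lim (\<lambda>n. dist (X n) (Y n))"
proof -
  have "Cauchy (\<lambda>n. dist (X n) (Y n))"
  proof (rule metric_CauchyI)
    fix e :: real assume "e > 0"
    then have "e / 2 > 0" by simp
    then obtain M N where M: "\<forall>m\<ge>M. \<forall>n\<ge>M. dist (X m) (X n) < e / 2"
      and N: "\<forall>m\<ge>N. \<forall>n\<ge>N. dist (Y m) (Y n) < e / 2"
      using assms unfolding Cauchy_def by meson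
    show "\<exists>K. \<forall>m\<ge>K. \<forall>n\<ge>K. dist (dist (X m) (Y m)) (dist (X n) (Y n)) < e"
    proof (intro exI allI impI)
      fix m n assume "m \<ge> max M N" "n \<ge> max M N"
      then have "dist (X m) (X n) < e / 2" "dist (Y m) (Y n) < e / 2" using M N by auto
      moreover have "\<bar>dist (X m) (Y m) - dist (X n) (Y n)\<bar> \<le> dist (X m) (X n) + dist (Y m) (Y n)"
        using dist_triangle[of "X m" "Y m" "X n"] dist_triangle[of "X n" "Y m" "Y n"]
          dist_triangle[of "X n" "Y n" "X m"] dist_triangle[of "X m" "Y n" "Y m"]
        by (simp add: dist_commute)
      ultimately show "dist (dist (X m) (Y m)) (dist (X n) (Y n)) < e"
        by (simp add: dist_real_def)
    qed
  qed
  then show ?thesis by (simp add: Cauchy_convergent_iff convergent_LIMSEQ_iff)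
qed

instantiation metric_completion :: (metric_space) metric_space
begin

lift_definition dist_metric_completion :: "'a metric_completion \<Rightarrow> 'a metric_completion \<Rightarrow> real"
  is "\<lambda>X Y. lim (\<lambda>n. dist (X n) (Y n))"
proof -
  fix X X' Y Y' :: "nat \<Rightarrow> 'a"
  assume *: "completion_rel X X'" "completion_rel Y Y'"
  then have s: "(\<lambda>n. dist (X n) (X' n) + dist (Y n) (Y' n)) \<longlonglongrightarrow> 0"
    unfolding completion_rel_def by (intro tendsto_add_zero) auto
  have le: "\<bar>dist (X n) (Y n) - dist (X' n) (Y' n)\<bar> \<le> dist (X n) (X' n) + dist (Y n) (Y' n)" for n
    using dist_triangle[of "X n" "Y n" "X' n"] dist_triangle[of "X' n" "Y n" "Y' n"]
      dist_triangle[of "X' n" "Y' n" "X n"] dist_triangle[of "X n" "Y' n" "Y n"]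
    by (simp add: dist_commute)
  have 0: "(\<lambda>n. dist (X n) (Y n) - dist (X' n) (Y' n)) \<longlonglongrightarrow> 0"
    by (rule Lim_null_comparison[OF _ s]) (use le in simp)
  have "(\<lambda>n. dist (X' n) (Y' n)) \<longlonglongrightarrow> lim (\<lambda>n. dist (X' n) (Y' n))"
    using * by (intro convergent_dist_Cauchy) (auto simp: completion_rel_def)
  from tendsto_add[OF 0 this]
  show "lim (\<lambda>n. dist (X n) (Y n)) = lim (\<lambda>n. dist (X' n) (Y' n))"
    by (intro limI) simp
qed

definition uniformity_metric_completion :: "('a metric_completion \<times> 'a metric_completion) filter" where
  "uniformity_metric_completion = (INF e\<in>{0 <..}. principal {(x, y). dist x y < e})"

definition open_metric_completion :: "'a metric_completion set \<Rightarrow> bool" where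
  "open_metric_completion S = (\<forall>x\<in>S. \<forall>\<^sub>F (x', y) in uniformity. x' = x \<longrightarrow> y \<in> S)"

instance
proof
  fix x y z :: "'a metric_completion"
  show "dist x y = 0 \<longleftrightarrow> x = y"
  proof transfer
    fix X Y :: "nat \<Rightarrow> 'a" assume *: "completion_rel X X" "completion_rel Y Y"
    then have l: "(\<lambda>n. dist (X n) (Y n)) \<longlonglongrightarrow> lim (\<lambda>n. dist (X n) (Y n))"
      by (intro convergent_dist_Cauchy) (auto simp: completion_rel_def)
    have "lim (\<lambda>n. dist (X n) (Y n)) = 0 \<longleftrightarrow> (\<lambda>n. dist (X n) (Y n)) \<longlonglongrightarrow> 0"
      using l limI by metis
    then show "lim (\<lambda>n. dist (X n) (Y n)) = 0 \<longleftrightarrow> completion_rel X Y"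
      using * by (simp add: completion_rel_def)
  qed
  show "dist x y \<le> dist x z + dist y z"
  proof transfer
    fix X Y Z :: "nat \<Rightarrow> 'a"
    assume "completion_rel X X" "completion_rel Y Y" "completion_rel Z Z"
    then have C: "Cauchy X" "Cauchy Y" "Cauchy Z" by (auto simp: completion_rel_def)
    show "lim (\<lambda>n. dist (X n) (Y n)) \<le> lim (\<lambda>n. dist (X n) (Z n)) + lim (\<lambda>n. dist (Y n) (Z n))"
      by (rule LIMSEQ_le[OF convergent_dist_Cauchy[OF C(1,2)]
            tendsto_add[OF convergent_dist_Cauchy[OF C(1,3)] convergent_dist_Cauchy[OF C(2,3)]]])
         (auto simp: dist_triangle2)
  qed
qed (simp_all add: uniformity_metric_completion_def open_metric_completion_def)

end

lift_definition to_completion :: "'a::metric_space \<Rightarrow> 'a metric_completion" is "\<lambda>x _. x"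
  by (auto simp: completion_rel_def intro: LIMSEQ_imp_Cauchy[OF tendsto_const])

lemma dist_to_completion: "dist (to_completion x) (to_completion y) = dist x y"
  by transfer (rule limI, rule tendsto_const)

lemma to_completion_approx:
  fixes x :: "'a::metric_space metric_completion"
  assumes "e > 0"
  shows "\<exists>a. dist x (to_completion a) < e"
proof (induct x rule: metric_completion.abs_induct)
  case (1 X)
  then have X: "completion_rel X X" .
  then have C: "Cauchy X" by (simp add: completion_rel_def)
  obtain N where N: "\<forall>m\<ge>N. \<forall>n\<ge>N. dist (X m) (X n) < e / 2"
    using C assms unfolding Cauchy_def by (meson half_gt_zero)
  have c: "completion_rel (\<lambda>_. X N) (\<lambda>_. X N)"
    by (auto simp: completion_rel_def intro: LIMSEQ_imp_Cauchy[OF tendsto_const])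
  have "(\<lambda>n. dist (X n) (X N)) \<longlonglongrightarrow> lim (\<lambda>n. dist (X n) (X N))"
    by (intro convergent_dist_Cauchy C LIMSEQ_imp_Cauchy[OF tendsto_const])
  then have "lim (\<lambda>n. dist (X n) (X N)) \<le> e / 2"
    by (rule LIMSEQ_le_const2) (use N in \<open>auto intro!: exI[of _ N] less_imp_le\<close>)
  then have "dist (abs_metric_completion X) (to_completion (X N)) < e"
    using assms by (simp add: to_completion.abs_eq dist_metric_completion.abs_eq[OF X c])
  then show ?case by blast
qed

lemma closure_range_to_completion: "closure (range to_completion) = UNIV"
  using to_completion_approx by (auto simp: closure_approachable dist_commute)

lemma to_completion_tendsto:
  fixes X :: "nat \<Rightarrow> 'a::metric_space"
  assumes "Cauchy X"
  shows "\<exists>x. (\<lambda>n. to_completion (X n)) \<longlonglongrightarrow> x"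
proof -
  have X: "completion_rel X X" using assms by (simp add: completion_rel_def)
  have "(\<lambda>n. to_completion (X n)) \<longlonglongrightarrow> abs_metric_completion X"
  proof (rule metric_LIMSEQ_I)
    fix e :: real assume "e > 0"
    then obtain N where N: "\<forall>m\<ge>N. \<forall>n\<ge>N. dist (X m) (X n) < e / 2"
      using assms unfolding Cauchy_def by (meson half_gt_zero)
    show "\<exists>N. \<forall>n\<ge>N. dist (to_completion (X n)) (abs_metric_completion X) < e"
    proof (intro exI allI impI)
      fix n assume "n \<ge> N"
      have c: "completion_rel (\<lambda>_. X n) (\<lambda>_. X n)"
        by (auto simp: completion_rel_def intro: LIMSEQ_imp_Cauchy[OF tendsto_const])
      have "(\<lambda>k. dist (X n) (X k)) \<longlonglongrightarrow> lim (\<lambda>k. dist (X n) (X k))"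
        by (intro convergent_dist_Cauchy assms LIMSEQ_imp_Cauchy[OF tendsto_const])
      then have "lim (\<lambda>k. dist (X n) (X k)) \<le> e / 2"
        by (rule LIMSEQ_le_const2) (use N \<open>n \<ge> N\<close> in \<open>auto intro!: exI[of _ N] less_imp_le\<close>)
      then show "dist (to_completion (X n)) (abs_metric_completion X) < e"
        using \<open>e > 0\<close> by (simp add: to_completion.abs_eq dist_metric_completion.abs_eq[OF c X])
    qed
  qed
  then show ?thesis by blast
qed

instance metric_completion :: (metric_space) complete_space
proof
  fix X :: "nat \<Rightarrow> 'a metric_completion" assume C: "Cauchy X"
  have "\<forall>n. \<exists>a. dist (X n) (to_completion a) < 1 / real (Suc n)"
    using to_completion_approx by (metis of_nat_0_less_iff zero_less_Suc zero_less_divide_1_iff)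
  then obtain A where A: "\<And>n. dist (X n) (to_completion (A n)) < 1 / real (Suc n)" by metis
  have inv0: "(\<lambda>n. 1 / real (Suc n)) \<longlonglongrightarrow> 0"
    using LIMSEQ_inverse_real_of_nat by (simp add: inverse_eq_divide)
  have d0: "(\<lambda>n. dist (X n) (to_completion (A n))) \<longlonglongrightarrow> 0"
    by (rule Lim_null_comparison[OF _ inv0]) (use A in \<open>simp add: less_imp_le\<close>)
  have "Cauchy A"
  proof (rule metric_CauchyI)
    fix e :: real assume "e > 0"
    then have e: "e / 3 > 0" by simp
    obtain M where M: "\<forall>m\<ge>M. \<forall>n\<ge>M. dist (X m) (X n) < e / 3"
      using C e unfolding Cauchy_def by meson
    obtain K where K: "\<forall>n\<ge>K. dist (X n) (to_completion (A n)) < e / 3"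
      using metric_LIMSEQ_D[OF d0 e] by auto
    show "\<exists>L. \<forall>m\<ge>L. \<forall>n\<ge>L. dist (A m) (A n) < e"
    proof (intro exI allI impI)
      fix m n assume "m \<ge> max M K" "n \<ge> max M K"
      then have "dist (X m) (X n) < e / 3" "dist (X m) (to_completion (A m)) < e / 3"
        "dist (X n) (to_completion (A n)) < e / 3" using M K by auto
      moreover have "dist (to_completion (A m)) (to_completion (A n))
          \<le> dist (X m) (to_completion (A m)) + dist (X m) (X n) + dist (X n) (to_completion (A n))"
        using dist_triangle[of "to_completion (A m)" "to_completion (A n)" "X m"]
          dist_triangle[of "X m" "to_completion (A n)" "X n"] by (simp add: dist_commute)
      ultimately show "dist (A m) (A n) < e" by (simp add: dist_to_completion)
    qed
  qed
  then obtain x where x: "(\<lambda>n. to_completion (A n)) \<longlonglongrightarrow> x" using to_completion_tendsto by blast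
  have s: "(\<lambda>n. dist (X n) (to_completion (A n)) + dist (to_completion (A n)) x) \<longlonglongrightarrow> 0"
    by (rule tendsto_add_zero[OF d0]) (rule tendsto_dist_iff[THEN iffD1, OF x])
  have "(\<lambda>n. dist (X n) x) \<longlonglongrightarrow> 0"
    by (rule Lim_null_comparison[OF _ s]) (simp add: dist_triangle)
  then have "X \<longlonglongrightarrow> x" by (rule tendsto_dist_iff[THEN iffD2])
  then show "convergent X" by (rule convergentI)
qed

type_synonym barcode_hat = "barcode metric_completion"


section \<open>Pettis integral\<close>

definition has_pettis_integral ::
    "'w measure \<Rightarrow> ('w \<Rightarrow> 'v::real_normed_vector) \<Rightarrow> 'v \<Rightarrow> bool" where
  "has_pettis_integral M \<xi> v \<longleftrightarrow>
     (\<forall>\<phi> :: 'v \<Rightarrow> real. bounded_linear \<phi> \<longrightarrow>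
        integrable M (\<lambda>w. \<phi> (\<xi> w)) \<and> \<phi> v = (LINT w|M. \<phi> (\<xi> w)))"

text \<open>
  If no Pettis integral exists, the value is arbitrary; statements should
  therefore also assert \<open>has_pettis_integral\<close>.
\<close>

definition pettis_integral :: "'w measure \<Rightarrow> ('w \<Rightarrow> 'v::real_normed_vector) \<Rightarrow> 'v" where
  "pettis_integral M \<xi> = (THE v. has_pettis_integral M \<xi> v)"

end

theory Submission
  imports Defs
begin

text \<open>
  The barcode space enters only as a measurable space: a continuous \<open>T\<close> is Borel, so the variables
  \<open>T (X i)\<close> are i.i.d. with values in a separable Banach space and Bochner integrable, and two things
  remain. The expectation has to be identified, and the strong law has to be proved for Banach space
  valued functions of an i.i.d. sequence.

  The Bochner integral commutes with bounded linear functionals, so it is a Pettis integral. As the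
  expectation is defined by a definite description, it must also be the only one; this holds because
  bounded linear functionals separate points (\<open>bounded_linear_separates_zero\<close>). That consequence of
  the Hahn--Banach theorem is derived from the fact that a sublinear functional which is minimal in the
  pointwise order is linear.

  The strong law for real variables rests on \<open>iid_sums_bounded_above\<close>: if the mean is negative, then
  almost surely the partial sums are bounded above. Let \<open>M n\<close> be the maximum of \<open>0\<close> and the first
  \<open>n\<close> partial sums, and \<open>M' n\<close> the same quantity for the sequence without its first term
  \<open>Y 0\<close>. Then \<open>M (n + 1) - M' n = max (- M' n) (Y 0)\<close>. The expectation of the left-hand side
  is nonnegative, since \<open>M' n\<close> has the law of \<open>M n \<le> M (n + 1)\<close>. If \<open>M n\<close>
  tended to infinity almost surely, then the right-hand side would converge to \<open>Y 0\<close>, dominated by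
  \<open>\<bar>Y 0\<bar>\<close>, and the mean of \<open>Y 0\<close> would be nonnegative. So \<open>M n\<close> tends to infinity with
  probability less than \<open>1\<close>, hence with probability \<open>0\<close> by Kolmogorov's law. Subtracting from
  \<open>Y i\<close> and from \<open>- Y i\<close> constants slightly above their means gives the two bounds of the
  strong law.

  For \<open>f\<close> with values in a Banach space, indicator functions reduce to the real case, the law is
  additive in \<open>f\<close>, and it passes to the limit of functions \<open>s k\<close> tending to \<open>f\<close> in mean: the error
  of replacing \<open>f\<close> by \<open>s k\<close> in the averages is at most an average of the real functions
  \<open>norm (s k x - f x)\<close>, which the real law controls.
\<close>

section \<open>Bounded linear functionals separate points\<close>

text \<open>
  The bound by the norm is part of the notion, so that linear examples are automatically bounded.
  Homogeneity is required only as an inequality, which is easier to check for infima; equality follows.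
\<close>

definition sublinear :: "('v::real_normed_vector \<Rightarrow> real) \<Rightarrow> bool" where
  "sublinear p \<longleftrightarrow> (\<forall>x y. p (x + y) \<le> p x + p y) \<and>
     (\<forall>t x. 0 \<le> t \<longrightarrow> p (t *\<^sub>R x) \<le> t * p x) \<and> (\<forall>x. p x \<le> norm x)"

lemma sublinearD:
  assumes "sublinear p"
  shows "p (x + y) \<le> p x + p y" "p x \<le> norm x" "0 \<le> t \<Longrightarrow> p (t *\<^sub>R x) = t * p x"
    "- norm x \<le> p x" "p 0 = 0"
proof -
  have add: "p (x + y) \<le> p x + p y" and le: "p x \<le> norm x"
    and hom: "0 \<le> t \<Longrightarrow> p (t *\<^sub>R x) \<le> t * p x" for x y t
    using assms by (auto simp: sublinear_def)
  show "p (x + y) \<le> p x + p y" "p x \<le> norm x" by (rule add le)+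
  show p0: "p 0 = 0"
    using add[of 0 0] hom[of 0 0] by simp
  show "p (t *\<^sub>R x) = t * p x" if "0 \<le> t"
  proof (cases "t = 0")
    case False
    then have "t > 0" using that by simp
    have "p x \<le> inverse t * p (t *\<^sub>R x)"
      using hom[of "inverse t" "t *\<^sub>R x"] \<open>t > 0\<close> by simp
    then have "t * p x \<le> p (t *\<^sub>R x)"
      using \<open>t > 0\<close> by (simp add: field_simps)
    then show ?thesis using hom[OF that, of x] by simp
  qed (simp add: p0)
  have neg: "- p (- x) \<le> p x"
    using add[of x "- x"] p0 by simp
  show "- norm x \<le> p x"
    using le[of "- x"] neg by simp
qed

text \<open>
  The infimum is at most \<open>p\<close> (take \<open>t = 0\<close>) and at most \<open>- p y\<close> at the point \<open>- y\<close> (take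
  \<open>t = 1\<close>). Tilting thus lowers a sublinear functional towards one that is linear along \<open>y\<close>.
\<close>

definition tilt :: "('v::real_normed_vector \<Rightarrow> real) \<Rightarrow> 'v \<Rightarrow> 'v \<Rightarrow> real" where
  "tilt p y x = (INF t\<in>{0..}. p (x + t *\<^sub>R y) - t * p y)"

lemma tilt_le:
  assumes "sublinear p" "0 \<le> t"
  shows "tilt p y x \<le> p (x + t *\<^sub>R y) - t * p y"
  unfolding tilt_def
proof (rule cINF_lower)
  \<comment> \<open>The bound is \<open>t * p y = p (t *\<^sub>R y) \<le> p (x + t *\<^sub>R y) + p (- x)\<close>.\<close>
  show "bdd_below ((\<lambda>t. p (x + t *\<^sub>R y) - t * p y) ` {0..})"
  proof (rule bdd_belowI2)
    fix s :: real assume "s \<in> {0..}"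
    then show "- p (- x) \<le> p (x + s *\<^sub>R y) - s * p y"
      using sublinearD(1)[OF assms(1), of "x + s *\<^sub>R y" "- x"] sublinearD(3)[OF assms(1), of s y]
      by simp
  qed
qed (use assms in simp)

lemma tilt_ge:
  assumes "\<And>t. 0 \<le> t \<Longrightarrow> c \<le> p (x + t *\<^sub>R y) - t * p y"
  shows "c \<le> tilt p y x"
  unfolding tilt_def by (rule cINF_greatest) (use assms in auto)

lemma tilt_le_self: "sublinear p \<Longrightarrow> tilt p y x \<le> p x"
  using tilt_le[of p 0 y x] by simp

text \<open>
  Subadditivity: the parameters \<open>s\<close> for \<open>x\<close> and \<open>t\<close> for \<open>z\<close> combine to the parameter \<open>s + t\<close> for
  \<open>x + z\<close>. Homogeneity: the parameter \<open>s\<close> for \<open>x\<close> corresponds to \<open>t * s\<close> for \<open>t *\<^sub>R x\<close>.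
\<close>

lemma sublinear_tilt:
  assumes p: "sublinear p"
  shows "sublinear (tilt p y)"
  unfolding sublinear_def
proof (intro conjI allI impI)
  fix x z
  have "tilt p y (x + z) - (p (z + t *\<^sub>R y) - t * p y) \<le> tilt p y x" if t: "0 \<le> t" for t
  proof (rule tilt_ge)
    fix s :: real assume s: "0 \<le> s"
    have "tilt p y (x + z) \<le> p (x + z + (s + t) *\<^sub>R y) - (s + t) * p y"
      using p s t by (intro tilt_le) auto
    also have "x + z + (s + t) *\<^sub>R y = (x + s *\<^sub>R y) + (z + t *\<^sub>R y)"
      by (simp add: algebra_simps)
    finally show "tilt p y (x + z) - (p (z + t *\<^sub>R y) - t * p y) \<le> p (x + s *\<^sub>R y) - s * p y"
      using sublinearD(1)[OF p, of "x + s *\<^sub>R y" "z + t *\<^sub>R y"] by (simp add: algebra_simps)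
  qed
  then have "tilt p y (x + z) - tilt p y x \<le> tilt p y z"
    by (intro tilt_ge) (simp add: algebra_simps)
  then show "tilt p y (x + z) \<le> tilt p y x + tilt p y z" by simp
next
  fix t :: real and x assume t: "0 \<le> t"
  show "tilt p y (t *\<^sub>R x) \<le> t * tilt p y x"
  proof (cases "t = 0")
    case True
    then show ?thesis using tilt_le_self[OF p, of y 0] sublinearD(5)[OF p] by simp
  next
    case False
    then have "t > 0" using t by simp
    have "tilt p y (t *\<^sub>R x) / t \<le> tilt p y x"
    proof (rule tilt_ge)
      fix s :: real assume s: "0 \<le> s"
      have "tilt p y (t *\<^sub>R x) \<le> p (t *\<^sub>R x + (t * s) *\<^sub>R y) - t * s * p y"
        using p s t by (intro tilt_le) auto
      also have "t *\<^sub>R x + (t * s) *\<^sub>R y = t *\<^sub>R (x + s *\<^sub>R y)"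
        by (simp add: algebra_simps)
      also have "p \<dots> = t * p (x + s *\<^sub>R y)"
        by (rule sublinearD(3)[OF p t])
      finally show "tilt p y (t *\<^sub>R x) / t \<le> p (x + s *\<^sub>R y) - s * p y"
        using \<open>t > 0\<close> by (simp add: field_simps)
    qed
    then show ?thesis using \<open>t > 0\<close> by (simp add: field_simps)
  qed
next
  fix x show "tilt p y x \<le> norm x"
    using tilt_le_self[OF p, of y x] sublinearD(2)[OF p, of x] by simp
qed

text \<open>
  The pointwise infimum works. It is finite as every sublinear functional is at least \<open>- norm\<close>, and
  \<open>u (x + y) \<le> p x + q y\<close> for members \<open>p\<close>, \<open>q\<close> because the smaller one of them bounds \<open>u\<close> at \<open>x + y\<close>.
\<close>

lemma sublinear_chain_bound:
  assumes C: "\<And>p. p \<in> C \<Longrightarrow> sublinear p" "C \<noteq> {}"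
    and chain: "\<And>p q. p \<in> C \<Longrightarrow> q \<in> C \<Longrightarrow> p \<le> q \<or> q \<le> p"
  shows "\<exists>u. sublinear u \<and> (\<forall>p\<in>C. u \<le> p)"
proof -
  define u where "u x = (INF p\<in>C. p x)" for x
  have le: "u x \<le> p x" if "p \<in> C" for p x
    unfolding u_def
    by (rule cINF_lower[OF bdd_belowI2[of _ "- norm x"]]) (use that C sublinearD(4) in auto)
  have ge: "c \<le> u x" if "\<And>p. p \<in> C \<Longrightarrow> c \<le> p x" for c x
    unfolding u_def by (rule cINF_greatest) (use that C in auto)
  have "sublinear u"
    unfolding sublinear_def
  proof (intro conjI allI impI)
    fix x y
    have "u (x + y) - q y \<le> u x" if q: "q \<in> C" for q
    proof (rule ge)
      fix p assume p: "p \<in> C"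
      obtain r where r: "r \<in> C" "r \<le> p" "r \<le> q"
        using chain[OF p q] p q by blast
      have "u (x + y) \<le> r x + r y"
        using le[OF r(1), of "x + y"] sublinearD(1)[OF C(1)[OF r(1)], of x y] by simp
      then show "u (x + y) - q y \<le> p x"
        using le_funD[OF r(2), of x] le_funD[OF r(3), of y] by simp
    qed
    then have "u (x + y) - u x \<le> u y"
      by (intro ge) (simp add: algebra_simps)
    then show "u (x + y) \<le> u x + u y" by simp
  next
    fix t :: real and x assume t: "0 \<le> t"
    obtain p0 where p0: "p0 \<in> C" using C by blast
    show "u (t *\<^sub>R x) \<le> t * u x"
    proof (cases "t = 0")
      case True
      then show ?thesis using le[OF p0, of 0] sublinearD(5)[OF C(1)[OF p0]] by simp
    next
      case False
      then have "t > 0" using t by simp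
      have "u (t *\<^sub>R x) / t \<le> u x"
      proof (rule ge)
        fix p assume p: "p \<in> C"
        show "u (t *\<^sub>R x) / t \<le> p x"
          using le[OF p, of "t *\<^sub>R x"] sublinearD(3)[OF C(1)[OF p] t, of x] \<open>t > 0\<close>
          by (simp add: field_simps)
      qed
      then show ?thesis using \<open>t > 0\<close> by (simp add: field_simps)
    qed
  next
    fix x
    obtain p0 where p0: "p0 \<in> C" using C by blast
    show "u x \<le> norm x"
      using le[OF p0, of x] sublinearD(2)[OF C(1)[OF p0], of x] by simp
  qed
  then show ?thesis using le by (auto simp: le_fun_def)
qed

lemma minimal_sublinear_below:
  fixes p :: "'v::real_normed_vector \<Rightarrow> real"
  assumes p: "sublinear p"
  shows "\<exists>q\<le>p. sublinear q \<and> (\<forall>r. sublinear r \<longrightarrow> r \<le> q \<longrightarrow> r = q)"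
proof -
  let ?A = "{q. sublinear q \<and> q \<le> p}"
  have "\<exists>m\<in>?A. \<forall>a\<in>?A. a \<le> m \<longrightarrow> a = m"
  proof (rule predicate_Zorn)
    show "partial_order_on ?A (relation_of (\<lambda>a b. b \<le> a) ?A)"
      by (rule partial_order_on_relation_ofI) auto
    fix C assume C: "C \<in> Chains (relation_of (\<lambda>a b. b \<le> a) ?A)"
    show "\<exists>u\<in>?A. \<forall>a\<in>C. u \<le> a"
    proof (cases "C = {}")
      case False
      have mem: "sublinear q" "q \<le> p" if "q \<in> C" for q
        using C that by (auto simp: Chains_def relation_of_def)
      have "q \<le> r \<or> r \<le> q" if "q \<in> C" "r \<in> C" for q r
        using C that by (auto simp: Chains_def relation_of_def)
      then obtain u where "sublinear u" "\<forall>q\<in>C. u \<le> q"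
        using sublinear_chain_bound[of C] mem False by blast
      moreover obtain q where "q \<in> C" using False by blast
      ultimately show ?thesis using mem(2)[of q] by (intro bexI[of _ u]) (auto intro: order_trans)
    qed (use p in auto)
  qed
  then obtain m where "m \<in> ?A" "\<forall>a\<in>?A. a \<le> m \<longrightarrow> a = m" ..
  then show ?thesis by (intro exI[of _ m]) (auto intro: order_trans)
qed

text \<open>
  A minimal functional is unchanged by tilting, and \<open>q = tilt q y\<close> with parameter \<open>1\<close> reads
  \<open>q x \<le> q (x + y) - q y\<close>, the inequality that subadditivity lacks for additivity.
\<close>

lemma minimal_sublinear_linear:
  assumes q: "sublinear q" and min: "\<And>r. sublinear r \<Longrightarrow> r \<le> q \<Longrightarrow> r = q"
  shows "bounded_linear q"
proof -
  have tilt: "tilt q y = q" for y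
    by (rule min) (auto intro: sublinear_tilt tilt_le_self q le_funI)
  have add: "q (x + y) = q x + q y" for x y
    using tilt_le[OF q, of 1 y x] sublinearD(1)[OF q, of x y] by (simp add: tilt)
  have neg: "q (- x) = - q x" for x
    using add[of x "- x"] sublinearD(5)[OF q] by simp
  show ?thesis
  proof (rule bounded_linear_intro[of _ 1])
    fix r x
    show "q (r *\<^sub>R x) = r *\<^sub>R q x"
    proof (cases "0 \<le> r")
      case False
      then have "q ((- r) *\<^sub>R x) = - r * q x"
        by (intro sublinearD(3)[OF q]) simp
      then show ?thesis using neg[of "r *\<^sub>R x"] by simp
    qed (simp add: sublinearD(3)[OF q])
    show "norm (q x) \<le> norm x * 1"
      using sublinearD(2,4)[OF q, of x] by auto
  qed (rule add)
qed

text \<open>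
  Minimising below \<open>tilt norm v\<close> rather than below the norm forces a nonzero value at \<open>v\<close>, because
  \<open>tilt norm v (- v) \<le> - norm v\<close>.
\<close>

theorem bounded_linear_separates_zero:
  fixes v :: "'v::real_normed_vector"
  assumes "v \<noteq> 0"
  shows "\<exists>\<phi>. bounded_linear \<phi> \<and> \<phi> v \<noteq> (0::real)"
proof -
  have n: "sublinear (norm :: 'v \<Rightarrow> real)"
    by (simp add: sublinear_def norm_triangle_ineq)
  obtain q where q: "q \<le> tilt norm v" "sublinear q"
    and min: "\<And>r. sublinear r \<Longrightarrow> r \<le> q \<Longrightarrow> r = q"
    using minimal_sublinear_below[OF sublinear_tilt[OF n]] by metis
  have lin: "bounded_linear q"
    by (rule minimal_sublinear_linear[OF q(2) min])
  have "q (- v) \<le> tilt norm v (- v)"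
    using q(1) by (rule le_funD)
  also have "\<dots> \<le> - norm v"
    using tilt_le[OF n, of 1 v "- v"] by simp
  also have "\<dots> < 0"
    using assms by simp
  finally have "q v \<noteq> 0"
    using linear_neg[OF bounded_linear.linear[OF lin], of v] by simp
  with lin show ?thesis by blast
qed

lemma pettis_integral_eq_integral:
  fixes \<xi> :: "'w \<Rightarrow> 'v::{banach, second_countable_topology}"
  assumes "integrable M \<xi>"
  shows "has_pettis_integral M \<xi> (integral\<^sup>L M \<xi>)" "pettis_integral M \<xi> = integral\<^sup>L M \<xi>"
proof -
  show *: "has_pettis_integral M \<xi> (integral\<^sup>L M \<xi>)"
    unfolding has_pettis_integral_def
    using assms by (auto intro: integrable_bounded_linear simp: integral_bounded_linear)
  show "pettis_integral M \<xi> = integral\<^sup>L M \<xi>"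
    unfolding pettis_integral_def
  proof (rule the_equality)
    fix v assume v: "has_pettis_integral M \<xi> v"
    have "\<phi> (v - integral\<^sup>L M \<xi>) = 0" if "bounded_linear \<phi>" for \<phi> :: "'v \<Rightarrow> real"
      using * v that linear_diff[OF bounded_linear.linear[OF that]]
      by (simp add: has_pettis_integral_def)
    then show "v = integral\<^sup>L M \<xi>"
      using bounded_linear_separates_zero[of "v - integral\<^sup>L M \<xi>"] by auto
  qed (rule *)
qed

section \<open>Partial sums with negative mean are bounded above\<close>

text \<open>
  \<open>walk_max n s\<close> is the largest of the partial sums \<open>0, s 0, s 0 + s 1, \<dots>\<close> with at most \<open>n\<close> terms.
  The recursion on the shifted sequence is the one in which the proof compares \<open>s\<close> with its shift.
\<close>

primrec walk_max :: "nat \<Rightarrow> (nat \<Rightarrow> real) \<Rightarrow> real" where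
  "walk_max 0 s = 0"
| "walk_max (Suc n) s = max 0 (s 0 + walk_max n (\<lambda>i. s (Suc i)))"

lemma walk_max_nonneg: "0 \<le> walk_max n s"
  by (cases n) auto

lemma walk_max_mono: "walk_max n s \<le> walk_max (Suc n) s"
proof (induction n arbitrary: s)
  case (Suc n)
  from Suc[of "\<lambda>i. s (Suc i)"] show ?case by simp
qed simp

lemma incseq_walk_max: "incseq (\<lambda>n. walk_max n s)"
  using walk_max_mono by (rule incseq_SucI)

lemma sum_le_walk_max: "(\<Sum>i<n. s i) \<le> walk_max n s"
proof (induction n arbitrary: s)
  case (Suc n)
  from Suc[of "\<lambda>i. s (Suc i)"] show ?case
    by (simp add: sum.lessThan_Suc_shift del: sum.lessThan_Suc)
qed simp

text \<open>
  The variables before index \<open>k\<close> are not involved; with \<open>M\<close> the \<open>\<sigma>\<close>-algebra generated by the variables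
  from index \<open>k\<close> on, this shows that unboundedness is a tail event.
\<close>

lemma walk_max_measurable:
  assumes "\<And>i. i \<ge> k \<Longrightarrow> Y i \<in> borel_measurable M"
  shows "(\<lambda>w. walk_max n (\<lambda>i. Y (k + i) w)) \<in> borel_measurable M"
  using assms
proof (induction n arbitrary: k)
  case (Suc n)
  have [measurable]: "Y k \<in> borel_measurable M" using Suc.prems by simp
  have [measurable]: "(\<lambda>w. walk_max n (\<lambda>i. Y (Suc (k + i)) w)) \<in> borel_measurable M"
    using Suc.IH[of "Suc k"] Suc.prems by simp
  show ?case by simp
qed simp

definition walk_unbounded :: "(nat \<Rightarrow> real) \<Rightarrow> bool" where
  "walk_unbounded s \<longleftrightarrow> (\<forall>K::nat. \<exists>n. real K < walk_max n s)"

text \<open>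
  Dropping the first term changes each maximum by at most its absolute value.
\<close>

lemma walk_unbounded_shift: "walk_unbounded (\<lambda>i. s (Suc i)) \<longleftrightarrow> walk_unbounded s"
proof
  assume L: "walk_unbounded (\<lambda>i. s (Suc i))"
  show "walk_unbounded s"
    unfolding walk_unbounded_def
  proof
    fix K :: nat
    obtain L :: nat where L': "real K - s 0 < real L" using reals_Archimedean2 by blast
    obtain n where "real L < walk_max n (\<lambda>i. s (Suc i))"
      using L unfolding walk_unbounded_def by blast
    with L' have "real K < walk_max (Suc n) s" by simp
    then show "\<exists>n. real K < walk_max n s" ..
  qed
next
  assume R: "walk_unbounded s"
  show "walk_unbounded (\<lambda>i. s (Suc i))"
    unfolding walk_unbounded_def
  proof
    fix K :: nat
    obtain L :: nat where L: "real K + \<bar>s 0\<bar> < real L" using reals_Archimedean2 by blast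
    obtain n where n: "real L < walk_max n s"
      using R unfolding walk_unbounded_def by blast
    also have "\<dots> \<le> walk_max (Suc n) s" by (rule walk_max_mono)
    finally have "real K < walk_max n (\<lambda>i. s (Suc i))" using L by (auto simp: max_def split: if_splits)
    then show "\<exists>n. real K < walk_max n (\<lambda>i. s (Suc i))" ..
  qed
qed

lemma walk_unbounded_shift_k: "walk_unbounded (\<lambda>i. s (k + i)) \<longleftrightarrow> walk_unbounded s"
proof (induction k)
  case (Suc k)
  then show ?case using walk_unbounded_shift[of "\<lambda>i. s (k + i)"] by simp
qed simp

lemma walk_unbounded_filterlim:
  assumes "walk_unbounded s"
  shows "filterlim (\<lambda>n. walk_max n s) at_top sequentially"
  unfolding filterlim_at_top
proof
  fix Z :: real
  obtain K :: nat where K: "Z < real K" using reals_Archimedean2 by blast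
  obtain n where n: "real K < walk_max n s" using assms unfolding walk_unbounded_def by blast
  show "\<forall>\<^sub>F n in sequentially. Z \<le> walk_max n s"
    using eventually_ge_at_top[of n]
  proof eventually_elim
    case (elim m)
    then show ?case using incseqD[OF incseq_walk_max[of s] elim] K n by simp
  qed
qed

context prob_space
begin

text \<open>
  Unboundedness is invariant under the shift, so for every \<open>k\<close> the event is expressed by the variables
  from index \<open>k\<close> on.
\<close>

lemma walk_unbounded_0_1:
  assumes indep: "indep_vars (\<lambda>_. borel) Y UNIV"
  shows "prob {w\<in>space M. walk_unbounded (\<lambda>i. Y i w)} \<in> {0, 1}"
proof -
  let ?F = "\<lambda>i. sigma_sets (space M) {Y i -` A \<inter> space M |A. A \<in> sets (borel :: real measure)}"
  let ?E = "{w\<in>space M. walk_unbounded (\<lambda>i. Y i w)}"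
  have sub: "?F i \<subseteq> Pow (space M)" for i
    using sigma_sets_into_sp[of "{Y i -` A \<inter> space M |A. A \<in> sets (borel :: real measure)}" "space M"]
    by auto
  have "?E \<in> sigma_sets (space M) (\<Union>i\<in>{k..}. ?F i)" for k
  proof -
    let ?N = "sigma (space M) (\<Union>i\<in>{k..}. ?F i)"
    have sN: "sets ?N = sigma_sets (space M) (\<Union>i\<in>{k..}. ?F i)"
      using sub by (intro sets_measure_of) auto
    have "Y i \<in> borel_measurable ?N" if "i \<ge> k" for i
    proof (rule measurableI)
      fix A :: "real set" assume "A \<in> sets borel"
      then have "Y i -` A \<inter> space M \<in> ?F i"
        by (intro sigma_sets.Basic) auto
      then have "Y i -` A \<inter> space M \<in> (\<Union>i\<in>{k..}. ?F i)"
        using that by blast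
      then show "Y i -` A \<inter> space ?N \<in> sets ?N"
        unfolding sN using sub by (simp add: space_measure_of_conv sigma_sets.Basic del: UN_iff)
    qed simp
    then have [measurable]: "(\<lambda>w. walk_max n (\<lambda>i. Y (k + i) w)) \<in> borel_measurable ?N" for n
      by (intro walk_max_measurable)
    have "{w\<in>space ?N. walk_unbounded (\<lambda>i. Y (k + i) w)} \<in> sets ?N"
      unfolding walk_unbounded_def by measurable
    then show ?thesis
      unfolding sN by (simp add: space_measure_of_conv walk_unbounded_shift_k[of "\<lambda>i. Y i _"])
  qed
  then have "?E \<in> tail_events ?F"
    unfolding tail_events_def by auto
  moreover have "indep_sets ?F UNIV"
    using indep unfolding indep_vars_def by auto
  ultimately have "prob ?E = 0 \<or> prob ?E = 1"
    by (intro kolmogorov_0_1_law[of ?F]) (auto intro!: sigma_algebra_sigma_sets)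
  then show ?thesis by auto
qed

lemma indep_vars_inj_reindex:
  assumes indep: "indep_vars (\<lambda>_. N) X I" and f: "inj_on f J" "f ` J \<subseteq> I"
  shows "indep_vars (\<lambda>_. N) (\<lambda>j. X (f j)) J"
proof -
  let ?F = "\<lambda>i. {X i -` A \<inter> space M |A. A \<in> sets N}"
  have rv: "\<forall>i\<in>I. X i \<in> measurable M N" and F: "indep_sets ?F I"
    using indep unfolding indep_vars_def2 by auto
  have "indep_sets (\<lambda>j. ?F (f j)) J"
  proof (rule indep_setsI)
    fix A K assume K: "K \<noteq> {}" "K \<subseteq> J" "finite K" "\<forall>j\<in>K. A j \<in> ?F (f j)"
    let ?g = "inv_into K f"
    have inj: "inj_on f K" using f(1) K(2) inj_on_subset by blast
    have "prob (\<Inter>i\<in>f ` K. A (?g i)) = (\<Prod>i\<in>f ` K. prob (A (?g i)))"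
    proof (rule indep_setsD[OF F])
      show "\<forall>i\<in>f ` K. A (?g i) \<in> ?F i"
        using K(4) inj by (auto simp: inv_into_f_f)
      show "f ` K \<subseteq> I" using K(2) f(2) by blast
    qed (use K in auto)
    then show "prob (\<Inter>j\<in>K. A j) = (\<Prod>j\<in>K. prob (A j))"
      using inj by (simp add: prod.reindex inv_into_f_f)
  next
    fix j assume "j \<in> J"
    then show "?F (f j) \<subseteq> events" using rv f(2) by (auto intro: measurable_sets)
  qed
  then show ?thesis
    using rv f(2) unfolding indep_vars_def2 by auto
qed

lemma distr_iid_sequence:
  assumes indep: "indep_vars (\<lambda>_. N) Y (UNIV :: nat set)"
    and ident: "\<And>i. distr M N (Y i) = D"
  shows "distr M (\<Pi>\<^sub>M i\<in>UNIV. N) (\<lambda>w i. Y i w) = (\<Pi>\<^sub>M i\<in>UNIV. D)"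
proof -
  have rv: "Y i \<in> measurable M N" for i
    using indep unfolding indep_vars_def by simp
  have "distr M (\<Pi>\<^sub>M i\<in>UNIV. N) (\<lambda>w. \<lambda>i\<in>UNIV. Y i w) = (\<Pi>\<^sub>M i\<in>UNIV. distr M N (Y i))"
    by (rule iffD1[OF indep_vars_iff_distr_eq_PiM indep]) (auto intro: rv)
  then show ?thesis by (simp add: ident restrict_def)
qed

text \<open>
  The whole sequence and its shift have the same law, the product of copies of the common distribution.
\<close>

lemma expectation_walk_max_shift:
  assumes indep: "indep_vars (\<lambda>_. borel) Y UNIV"
    and ident: "\<And>i. distr M borel (Y i) = distr M borel (Y 0)"
  shows "expectation (\<lambda>w. walk_max n (\<lambda>i. Y (Suc i) w)) = expectation (\<lambda>w. walk_max n (\<lambda>i. Y i w))"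
proof -
  let ?S = "\<Pi>\<^sub>M i\<in>(UNIV::nat set). (borel :: real measure)"
  have rv: "Y i \<in> borel_measurable M" for i
    using indep unfolding indep_vars_def by simp
  have W: "walk_max n \<in> borel_measurable ?S"
    using walk_max_measurable[of 0 "\<lambda>i s. s i" ?S n] by simp
  have meas: "(\<lambda>w i. Z i w) \<in> measurable M ?S" if "\<And>i. Z i \<in> borel_measurable M" for Z
    using that by (intro measurable_PiM_single') auto
  have law: "distr M ?S (\<lambda>w i. Y (Suc i) w) = distr M ?S (\<lambda>w i. Y i w)"
    using distr_iid_sequence[OF indep ident]
      distr_iid_sequence[OF indep_vars_inj_reindex[OF indep, of Suc UNIV] ident] by simp
  have "expectation (\<lambda>w. walk_max n (\<lambda>i. Y (Suc i) w)) =
      integral\<^sup>L (distr M ?S (\<lambda>w i. Y (Suc i) w)) (walk_max n)"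
    using W rv by (intro integral_distr[symmetric] meas) auto
  also have "\<dots> = expectation (\<lambda>w. walk_max n (\<lambda>i. Y i w))"
    unfolding law using W rv by (intro integral_distr meas) auto
  finally show ?thesis .
qed

lemma integrable_walk_max:
  assumes "\<And>i. integrable M (Y i)"
  shows "integrable M (\<lambda>w. walk_max n (\<lambda>i. Y i w))"
  using assms
proof (induction n arbitrary: Y)
  case (Suc n)
  have "integrable M (\<lambda>w. walk_max n (\<lambda>i. Y (Suc i) w))"
    by (rule Suc.IH) (rule Suc.prems)
  then show ?case using Suc.prems[of 0] by simp
qed simp

text \<open>
  The quantity \<open>?D n\<close> below is \<open>walk_max (Suc n)\<close> of the sequence minus \<open>walk_max n\<close> of its shift. Its
  mean is nonnegative, but where the walk is unbounded it tends to \<open>Y 0\<close>, whose mean is negative.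
\<close>

theorem iid_sums_bounded_above:
  fixes Y :: "nat \<Rightarrow> 'a \<Rightarrow> real"
  assumes indep: "indep_vars (\<lambda>_. borel) Y UNIV"
    and ident: "\<And>i. distr M borel (Y i) = distr M borel (Y 0)"
    and int: "integrable M (Y 0)" and neg: "expectation (Y 0) < 0"
  shows "AE w in M. \<exists>K. \<forall>n. (\<Sum>i<n. Y i w) \<le> K"
proof -
  have rv: "Y i \<in> borel_measurable M" for i
    using indep unfolding indep_vars_def by simp
  have int': "integrable M (Y i)" for i
    using integrable_distr_eq[OF rv, of "\<lambda>x. x" i] integrable_distr_eq[OF rv, of "\<lambda>x. x" 0]
      ident[of i] int by simp
  let ?E = "{w\<in>space M. walk_unbounded (\<lambda>i. Y i w)}"
  have [measurable]: "(\<lambda>w. walk_max n (\<lambda>i. Y i w)) \<in> borel_measurable M" for n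
    using walk_max_measurable[of 0 Y] rv by simp
  have E: "?E \<in> events"
    unfolding walk_unbounded_def by measurable
  let ?D = "\<lambda>n w. max (- walk_max n (\<lambda>i. Y (Suc i) w)) (Y 0 w)"
  have D_nonneg: "0 \<le> expectation (?D n)" for n
  proof -
    have i1: "integrable M (\<lambda>w. walk_max m (\<lambda>i. Y i w))" for m
      using int' by (rule integrable_walk_max)
    have i2: "integrable M (\<lambda>w. walk_max m (\<lambda>i. Y (Suc i) w))" for m
      using int' by (rule integrable_walk_max)
    have "?D n = (\<lambda>w. walk_max (Suc n) (\<lambda>i. Y i w) - walk_max n (\<lambda>i. Y (Suc i) w))"
      by (auto simp: max_def fun_eq_iff)
    then have "expectation (?D n) =
        expectation (\<lambda>w. walk_max (Suc n) (\<lambda>i. Y i w)) - expectation (\<lambda>w. walk_max n (\<lambda>i. Y (Suc i) w))"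
      using i1[of "Suc n"] i2[of n] by (simp del: walk_max.simps)
    also have "\<dots> = expectation (\<lambda>w. walk_max (Suc n) (\<lambda>i. Y i w)) - expectation (\<lambda>w. walk_max n (\<lambda>i. Y i w))"
      by (simp only: expectation_walk_max_shift[OF indep ident])
    also have "\<dots> \<ge> 0"
      using integral_mono[OF i1 i1, of n "Suc n"] walk_max_mono by (simp del: walk_max.simps)
    finally show ?thesis .
  qed
  have "prob ?E \<noteq> 1"
  proof
    assume "prob ?E = 1"
    then have ae: "AE w in M. walk_unbounded (\<lambda>i. Y i w)"
      using E by (simp add: prob_Collect_eq_1)
    have "(\<lambda>n. expectation (?D n)) \<longlonglongrightarrow> expectation (Y 0)"
    proof (rule integral_dominated_convergence)
      show "?D n \<in> borel_measurable M" for n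
        using walk_max_measurable[of 1 Y M n] rv by (intro borel_measurable_max) auto
      show "AE w in M. (\<lambda>n. ?D n w) \<longlonglongrightarrow> Y 0 w"
        using ae
      proof eventually_elim
        case (elim w)
        then have "walk_unbounded (\<lambda>i. Y (Suc i) w)"
          using walk_unbounded_shift[of "\<lambda>i. Y i w"] by simp
        then have "\<forall>\<^sub>F n in sequentially. - Y 0 w \<le> walk_max n (\<lambda>i. Y (Suc i) w)"
          using walk_unbounded_filterlim unfolding filterlim_at_top by blast
        then have "\<forall>\<^sub>F n in sequentially. Y 0 w = ?D n w"
          by eventually_elim simp
        then show ?case by (rule Lim_transform_eventually[OF tendsto_const])
      qed
      show "AE w in M. norm (?D n w) \<le> \<bar>Y 0 w\<bar>" for n
        using walk_max_nonneg[of n] by (intro AE_I2) (auto simp: max_def abs_if; smt (verit))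
    qed (use int rv in auto)
    then have "0 \<le> expectation (Y 0)"
      by (rule LIMSEQ_le_const) (use D_nonneg in auto)
    then show False using neg by simp
  qed
  then have "prob ?E = 0"
    using walk_unbounded_0_1[OF indep] by auto
  then have "AE w in M. \<not> walk_unbounded (\<lambda>i. Y i w)"
    using E by (simp add: prob_Collect_eq_0)
  then show ?thesis
  proof eventually_elim
    case (elim w)
    then obtain K :: nat where "\<And>n. walk_max n (\<lambda>i. Y i w) \<le> real K"
      unfolding walk_unbounded_def by (auto simp: not_less)
    then have "\<forall>n. (\<Sum>i<n. Y i w) \<le> real K"
      using sum_le_walk_max[of "\<lambda>i. Y i w"] by (blast intro: order_trans)
    then show ?case ..
  qed
qed

section \<open>Strong laws of large numbers\<close>

lemma iid_compose:
  assumes indep: "indep_vars (\<lambda>_. N) X I"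
    and ident: "\<And>i. i \<in> I \<Longrightarrow> distr M N (X i) = D"
    and g: "g \<in> measurable N K"
  shows "indep_vars (\<lambda>_. K) (\<lambda>i w. g (X i w)) I"
    and "\<And>i. i \<in> I \<Longrightarrow> distr M K (\<lambda>w. g (X i w)) = distr D K g"
proof -
  show "indep_vars (\<lambda>_. K) (\<lambda>i w. g (X i w)) I"
    using indep g by (rule indep_vars_compose2)
  fix i assume i: "i \<in> I"
  then have "X i \<in> measurable M N"
    using indep unfolding indep_vars_def by simp
  then show "distr M K (\<lambda>w. g (X i w)) = distr D K g"
    using distr_distr[OF g, of "X i" M] ident[OF i] by (simp add: comp_def)
qed

text \<open>
  For \<open>d\<close> strictly between the mean and \<open>c\<close>, the sums of \<open>Y i - d\<close> are bounded by some \<open>K\<close>, so the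
  averages are at most \<open>d + K / n\<close>.
\<close>

lemma eventually_average_less:
  assumes indep: "indep_vars (\<lambda>_. borel) Y UNIV"
    and ident: "\<And>i. distr M borel (Y i) = distr M borel (Y 0)"
    and int: "integrable M (Y 0)" and c: "expectation (Y 0) < c"
  shows "AE w in M. \<forall>\<^sub>F n in sequentially. (\<Sum>i<n. Y i w) / real n < c"
proof -
  define d where "d = (expectation (Y 0) + c) / 2"
  have d: "expectation (Y 0) < d" "d < c" using c by (auto simp: d_def)
  have "AE w in M. \<exists>K. \<forall>n. (\<Sum>i<n. Y i w - d) \<le> K"
  proof (rule iid_sums_bounded_above)
    show "expectation (\<lambda>w. Y 0 w - d) < 0"
      using int d by (simp add: prob_space)
    show "indep_vars (\<lambda>_. borel) (\<lambda>i w. Y i w - d) UNIV"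
      by (rule iid_compose(1)[OF indep ident]) simp
    show "distr M borel (\<lambda>w. Y i w - d) = distr M borel (\<lambda>w. Y 0 w - d)" for i
      by (simp add: iid_compose(2)[OF indep ident, of "\<lambda>x. x - d" borel])
  qed (use int in simp)
  then show ?thesis
  proof eventually_elim
    case (elim w)
    then obtain K where K: "\<And>n. (\<Sum>i<n. Y i w - d) \<le> K" by blast
    obtain m :: nat where m: "K / (c - d) < real m" using reals_Archimedean2 by blast
    show ?case
      using eventually_gt_at_top[of m]
    proof eventually_elim
      case (elim n)
      have "(\<Sum>i<n. Y i w) \<le> K + real n * d"
        using K[of n] by (simp add: sum_subtractf)
      also have "K < real m * (c - d)"
        using m d by (simp add: field_simps)
      also have "real m * (c - d) \<le> real n * (c - d)"
        using elim d by (intro mult_right_mono) auto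
      finally have "(\<Sum>i<n. Y i w) < real n * c"
        by (simp add: algebra_simps)
      then show ?case using elim by (simp add: field_simps)
    qed
  qed
qed

theorem strong_law_of_large_numbers_real:
  assumes indep: "indep_vars (\<lambda>_. borel) Y UNIV"
    and ident: "\<And>i. distr M borel (Y i) = distr M borel (Y 0)"
    and int: "integrable M (Y 0)"
  shows "AE w in M. (\<lambda>n. (\<Sum>i<n. Y i w) / real n) \<longlonglongrightarrow> expectation (Y 0)"
proof -
  let ?\<mu> = "expectation (Y 0)" and ?A = "\<lambda>w n. (\<Sum>i<n. Y i w) / real n"
  have up: "AE w in M. \<forall>m. \<forall>\<^sub>F n in sequentially. ?A w n < ?\<mu> + 1 / real (Suc m)"
    unfolding AE_all_countable
    by (intro allI eventually_average_less indep ident int) simp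
  have "AE w in M. \<forall>m. \<forall>\<^sub>F n in sequentially. (\<Sum>i<n. - Y i w) / real n < - ?\<mu> + 1 / real (Suc m)"
    unfolding AE_all_countable
  proof (intro allI eventually_average_less)
    show "indep_vars (\<lambda>_. borel) (\<lambda>i w. - Y i w) UNIV"
      by (rule iid_compose(1)[OF indep ident]) simp
    show "distr M borel (\<lambda>w. - Y i w) = distr M borel (\<lambda>w. - Y 0 w)" for i
      by (simp add: iid_compose(2)[OF indep ident, of "\<lambda>x. - x" borel])
  qed (use int in simp_all)
  with up show ?thesis
  proof eventually_elim
    case (elim w)
    show ?case
    proof (rule LIMSEQ_I)
      fix e :: real assume "0 < e"
      then obtain m where m: "1 / real (Suc m) < e" using nat_approx_posE by blast
      have "\<forall>\<^sub>F n in sequentially. norm (?A w n - ?\<mu>) < e"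
        using elim(1)[rule_format, of m] elim(2)[rule_format, of m]
      proof eventually_elim
        case (elim n)
        then show ?case using m by (simp add: sum_negf abs_less_iff del: of_nat_Suc)
      qed
      then show "\<exists>no. \<forall>n\<ge>no. norm (?A w n - ?\<mu>) < e"
        by (simp add: eventually_sequentially)
    qed
  qed
qed

text \<open>
  Stating the law for functions \<open>f\<close> of an i.i.d. sequence, instead of for Banach space valued variables,
  allows induction over the integrable functions \<open>f\<close> with the sequence fixed.
\<close>

theorem strong_law_of_large_numbers:
  fixes f :: "'b \<Rightarrow> 'v::{banach, second_countable_topology}"
  assumes indep: "indep_vars (\<lambda>_. N) X (UNIV :: nat set)"
    and ident: "\<And>i. distr M N (X i) = D"
    and int: "integrable D f"
  shows "AE w in M. (\<lambda>n. (\<Sum>i<n. f (X i w)) /\<^sub>R real n) \<longlonglongrightarrow> integral\<^sup>L D f"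
proof -
  have rv: "X i \<in> measurable M N" for i
    using indep unfolding indep_vars_def by simp
  have sets_D: "sets D = sets N"
    using ident[of 0] by auto
  have space_D: "space D = space N"
    using sets_D by (rule sets_eq_imp_space_eq)
  have real_law: "AE w in M. (\<lambda>n. (\<Sum>i<n. g (X i w)) / real n) \<longlonglongrightarrow> integral\<^sup>L D g"
    if g: "integrable D g" for g :: "'b \<Rightarrow> real"
  proof -
    have gN: "g \<in> borel_measurable N"
      using g sets_D by (simp cong: measurable_cong_sets)
    have "integrable M (\<lambda>w. g (X 0 w))" and I: "expectation (\<lambda>w. g (X 0 w)) = integral\<^sup>L D g"
      using g integrable_distr_eq[OF rv gN, of 0] integral_distr[OF rv gN, of 0] by (simp_all add: ident)
    then show ?thesis
      using strong_law_of_large_numbers_real[of "\<lambda>i w. g (X i w)"]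
        iid_compose[OF indep ident gN] by simp
  qed
  from int show ?thesis
  proof (induction rule: integrable_induct)
    case (base A c)
    have "integrable D (indicator A :: 'b \<Rightarrow> real)"
      using base by simp
    from real_law[OF this] show ?case
    proof eventually_elim
      case (elim w)
      then have "(\<lambda>n. ((\<Sum>i<n. indicator A (X i w)) / real n) *\<^sub>R c) \<longlonglongrightarrow> integral\<^sup>L D (indicator A) *\<^sub>R c"
        by (intro tendsto_intros)
      then show ?case
        using base by (simp add: scaleR_sum_left[symmetric] divide_inverse mult.commute)
    qed
  next
    case (add f g)
    from add.IH show ?case
    proof eventually_elim
      case (elim w)
      from tendsto_add[OF elim] show ?case
        using add by (simp add: sum.distrib scaleR_add_right)
    qed
  next
    case (lim f s)
    let ?u = "\<lambda>k x. norm (s k x - f x)"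
    have int_u: "integrable D (?u k)" for k
      using lim by auto
    have u0: "(\<lambda>k. integral\<^sup>L D (?u k)) \<longlonglongrightarrow> 0"
    proof -
      have "(\<lambda>k. integral\<^sup>L D (?u k)) \<longlonglongrightarrow> integral\<^sup>L D (\<lambda>_. 0)"
      proof (rule integral_dominated_convergence[where w = "\<lambda>x. 3 * norm (f x)"])
        show "AE x in D. (\<lambda>k. ?u k x) \<longlonglongrightarrow> 0"
        proof (rule AE_I2)
          fix x assume "x \<in> space D"
          from LIM_zero[OF lim.hyps(2)[OF this]] show "(\<lambda>k. ?u k x) \<longlonglongrightarrow> 0"
            by (rule tendsto_norm_zero)
        qed
        \<comment> \<open>The approximating functions satisfy \<open>norm (s k x) \<le> 2 * norm (f x)\<close>.\<close>
        show "AE x in D. norm (?u k x) \<le> 3 * norm (f x)" for k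
        proof (rule AE_I2)
          fix x assume "x \<in> space D"
          then show "norm (?u k x) \<le> 3 * norm (f x)"
            using lim.hyps(3)[of x k] norm_triangle_ineq4[of "s k x" "f x"] by simp
        qed
      qed (use int_u lim in auto)
      then show ?thesis by simp
    qed
    have "AE w in M. \<forall>k. (\<lambda>n. (\<Sum>i<n. ?u k (X i w)) / real n) \<longlonglongrightarrow> integral\<^sup>L D (?u k)"
      unfolding AE_all_countable using real_law[OF int_u] by blast
    moreover have "AE w in M. \<forall>k. (\<lambda>n. (\<Sum>i<n. s k (X i w)) /\<^sub>R real n) \<longlonglongrightarrow> integral\<^sup>L D (s k)"
      unfolding AE_all_countable using lim.IH by blast
    ultimately show ?case
    proof eventually_elim
      case (elim w)
      let ?A = "\<lambda>g n. (\<Sum>i<n. g (X i w)) /\<^sub>R real n"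
      show ?case
      proof (rule LIMSEQ_I)
        fix e :: real assume "0 < e"
        then have e3: "0 < e / 3" by simp
        obtain k where k: "integral\<^sup>L D (?u k) < e / 3"
          using order_tendstoD(2)[OF u0 e3] by (auto simp: eventually_sequentially)
        have I: "norm (integral\<^sup>L D (s k) - integral\<^sup>L D f) < e / 3"
        proof -
          have "integral\<^sup>L D (s k) - integral\<^sup>L D f = integral\<^sup>L D (\<lambda>x. s k x - f x)"
            using lim by simp
          then show ?thesis
            using le_less_trans[OF integral_norm_bound[of D "\<lambda>x. s k x - f x"] k] by (simp only:)
        qed
        have "\<forall>\<^sub>F n in sequentially. (\<Sum>i<n. ?u k (X i w)) / real n < e / 3"
          using order_tendstoD(2)[OF elim(1)[rule_format] k] .
        moreover have "\<forall>\<^sub>F n in sequentially. norm (?A (s k) n - integral\<^sup>L D (s k)) < e / 3"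
          using tendstoD[OF elim(2)[rule_format, of k] e3] by (simp add: dist_norm)
        ultimately have "\<forall>\<^sub>F n in sequentially. norm (?A f n - integral\<^sup>L D f) < e"
        proof eventually_elim
          case (elim n)
          have "norm (?A (s k) n - ?A f n) = norm (\<Sum>i<n. s k (X i w) - f (X i w)) / real n"
            by (simp add: scaleR_diff_right[symmetric] sum_subtractf divide_inverse)
          also have "\<dots> \<le> (\<Sum>i<n. ?u k (X i w)) / real n"
            by (intro divide_right_mono norm_sum) simp
          also have "\<dots> < e / 3" by (rule elim(1))
          finally have "norm (?A (s k) n - ?A f n) < e / 3" .
          then have "norm (?A f n - ?A (s k) n) < e / 3"
            by (simp only: norm_minus_commute)
          from norm_add_less[OF norm_add_less[OF this elim(2)] I] show ?case by simp
        qed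
        then show "\<exists>no. \<forall>n\<ge>no. norm (?A f n - integral\<^sup>L D f) < e"
          by (simp add: eventually_sequentially)
      qed
    qed
  qed
qed

end

section \<open>The strong law for maps on barcodes\<close>

theorem theorem4p1:
  fixes T :: "barcode_hat \<Rightarrow> 'v::{banach, second_countable_topology}"
    and P :: "'w measure"
    and X :: "nat \<Rightarrow> 'w \<Rightarrow> barcode_hat"
  assumes "continuous_on UNIV T"
    and "prob_space P"
    and "prob_space.indep_vars P (\<lambda>_. borel) X {1..}"
    and "\<And>i. i \<ge> 1 \<Longrightarrow> distr P borel (X i) = distr P borel (X 1)"
    and "integrable P (\<lambda>w. norm (T (X 1 w)))"
  shows "has_pettis_integral P (\<lambda>w. T (X 1 w)) (pettis_integral P (\<lambda>w. T (X 1 w))) \<and>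
    (AE w in P. (\<lambda>n. (\<Sum>i=1..n. T (X i w)) /\<^sub>R real n)
       \<longlonglongrightarrow> pettis_integral P (\<lambda>w. T (X 1 w)))"
proof -
  interpret prob_space P by fact
  have T: "T \<in> borel_measurable borel"
    using assms(1) by (rule borel_measurable_continuous_onI)
  have X1: "X 1 \<in> measurable P borel"
    using assms(3) unfolding indep_vars_def by simp
  have TX: "integrable P (\<lambda>w. T (X 1 w))"
    using assms(5) measurable_compose[OF X1 T] by (simp add: integrable_norm_iff)
  have "indep_vars (\<lambda>_. borel) (\<lambda>i. X (Suc i)) UNIV"
    using assms(3) by (rule indep_vars_inj_reindex) auto
  then have "AE w in P. (\<lambda>n. (\<Sum>i<n. T (X (Suc i) w)) /\<^sub>R real n)
      \<longlonglongrightarrow> integral\<^sup>L (distr P borel (X 1)) T"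
  proof (rule strong_law_of_large_numbers)
    show "distr P borel (X (Suc i)) = distr P borel (X 1)" for i
      by (rule assms(4)) simp
    show "integrable (distr P borel (X 1)) T"
      using TX X1 T by (simp add: integrable_distr_eq)
  qed
  moreover have "integral\<^sup>L (distr P borel (X 1)) T = pettis_integral P (\<lambda>w. T (X 1 w))"
    using X1 T pettis_integral_eq_integral(2)[OF TX] by (simp add: integral_distr)
  ultimately show ?thesis
    using pettis_integral_eq_integral[OF TX] by (simp add: sum.atLeast1_atMost_eq)
qed

end
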